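(* For every positive integer $n$, there exist a group $G$ and a subsemigroup $M$ of $G$ such that the $n$-fold product $M\,M^{-1}\,M\,M^{-1}\cdots M^{(-1)^{n-1}}$ (with $n$ factors, alternately $M$ and $M^{-1}$, beginning with $M$) is equal to $G$, but for every $m$ with $1\le m<n$, the $m$-fold initial subproduct $M\,M^{-1}\,M\,M^{-1}\cdots M^{(-1)^{m-1}}$ is not equal to $G$.
   Context: For subsets $S,T$ of a group $G$, $S\,T=\{gh : g\in S,\ h\in T\}$ and $S^{-1}=\{g^{-1} : g\in S\}$. A subsemigroup of $G$ is a subset closed under the multiplication of $G$. *)

theory Defs
  imports "HOL-Algebra.Coset"
begin

text \<open>The empty set counts as a subsemigroup: closure under multiplication is all that is required.\<close>

definition subsemigroup :: "'a set \<Rightarrow> ('a, 'b) monoid_scheme \<Rightarrow> bool" where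
  "subsemigroup M G \<longleftrightarrow> M \<subseteq> carrier G \<and> (\<forall>x\<in>M. \<forall>y\<in>M. x \<otimes>\<^bsub>G\<^esub> y \<in> M)"

text \<open>The product with \<open>n\<close> factors, alternately \<open>M\<close> and its set of inverses, beginning with \<open>M\<close>.
  The recursion appends the factor with number \<open>Suc k\<close> on the right; its exponent is \<open>(-1)\<close> to
  the power \<open>k\<close>. The empty product is the trivial subgroup, so that the one-factor product is
  \<open>M\<close> for every subset \<open>M\<close> of a group.\<close>

primrec alt_prod :: "('a, 'b) monoid_scheme \<Rightarrow> 'a set \<Rightarrow> nat \<Rightarrow> 'a set" where
  "alt_prod G M 0 = {\<one>\<^bsub>G\<^esub>}"
| "alt_prod G M (Suc k) = alt_prod G M k <#>\<^bsub>G\<^esub> (if even k then M else set_inv\<^bsub>G\<^esub> M)"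

lemma (in group) alt_prod_Suc_0:
  assumes "M \<subseteq> carrier G"
  shows "alt_prod G M (Suc 0) = M"
  using assms by (force simp: set_mult_def)

lemma (in group) alt_prod_2:
  assumes "M \<subseteq> carrier G"
  shows "alt_prod G M 2 = M <#> set_inv M"
  using alt_prod_Suc_0[OF assms] by (simp add: numeral_2_eq_2)

text \<open>An existential quantifier over groups has to fix the type of their elements. The type
  \<open>nat \<Rightarrow> nat\<close> has the cardinality of the continuum, so up to isomorphism it carries
  every countable group and every group of permutations of a countable set.
  This loses no generality in an existence statement: that a given alternating product of a
  subset is, or is not, the whole group is a first-order property of the group with a predicate
  for the subset, so by the downward Loewenheim-Skolem theorem any example contains a countable one.\<close>

type_synonym seq_monoid = "(nat \<Rightarrow> nat) monoid"

end

theory Submission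
  imports Defs "HOL-Combinatorics.Transposition" "HOL-Library.Infinite_Set"
begin

text \<open>
  Colour the natural numbers by their residue modulo \<open>n\<close>, and order the colours as a
  \<^emph>\<open>fence\<close> \<open>0 > 1 < 2 > 3 < \<dots>\<close> in which only neighbours are comparable. Let \<open>G\<close> consist of the
  permutations that change the colours of only finitely many points, and let \<open>M\<close> consist of those
  elements of \<open>G\<close> that never raise the colour of a point; \<open>M\<close> is closed under composition because
  the fence is a partial order.

  \<^emph>\<open>Fewer than \<open>n\<close> factors are not enough.\<close> An element of \<open>M\<close> or of its set of inverses moves each
  colour to itself or to a neighbour, and an element of \<open>M\<close> cannot bring any other colour to the
  maximal colour \<open>0\<close>. In a product of \<open>m\<close> factors the leftmost one, which acts last, lies in \<open>M\<close>,
  so only points of colour less than \<open>m\<close> can arrive at colour \<open>0\<close> (\<open>alt_prod_colour_bound\<close>). The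
  transposition of a point of colour \<open>0\<close> and a point of colour \<open>n - 1\<close> is therefore not such a
  product when \<open>m < n\<close>.

  \<^emph>\<open>All of \<open>G\<close> is reached with \<open>n\<close> factors.\<close> Walking along the fence from the final colour of a
  point back to its original colour, the alternation of the factors always permits the next step,
  after one possible delay at the beginning; there are at most \<open>n - 1\<close> steps to make, so \<open>n\<close>
  factors are enough for each single point. It remains to realise these finitely many nontrivial
  walks by permutations simultaneously. As all but finitely many points keep their colour all the
  time, at each stage every colour class is still infinite, and so the prescribed intermediate
  colouring is the old colouring composed with a permutation (\<open>ex_perm_colouring\<close>).
\<close>

section \<open>The fence\<close>

definition fence_le :: "nat \<Rightarrow> nat \<Rightarrow> bool" where
  "fence_le a b \<longleftrightarrow> a = b \<or> (odd a \<and> (b = Suc a \<or> a = Suc b))"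

lemma fence_le_refl [simp]: "fence_le a a"
  by (simp add: fence_le_def)

lemma fence_le_trans: "fence_le a b \<Longrightarrow> fence_le b d \<Longrightarrow> fence_le a d"
  by (auto simp: fence_le_def)

text \<open>In closed form: there are colours \<open>b = d\<^sub>0 \<le> d\<^sub>1 \<ge> d\<^sub>2 \<le> \<dots> d\<^sub>k = a\<close> in the fence. An odd colour
  is minimal, so the walk can set out at once; an even one is maximal, so that the first step,
  which goes up, is a rest. This is the summand \<open>1\<close>. Once moving, the walk alternates between odd
  and even colours and never has to rest again.\<close>

definition fence_reach :: "nat \<Rightarrow> nat \<Rightarrow> nat \<Rightarrow> bool" where
  "fence_reach k b a \<longleftrightarrow>
     a = b \<or> \<bar>int a - int b\<bar> + (if even b then 1 else 0) \<le> int k"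

lemma fence_reach_1: "fence_reach (Suc 0) b a \<Longrightarrow> fence_le b a"
  by (auto simp: fence_reach_def fence_le_def split: if_splits)

lemma fence_reach_full:
  assumes "a < n" "b < n"
  shows "fence_reach n b a"
  using assms by (auto simp: fence_reach_def)

text \<open>If no slack is left, the colour \<open>d\<close> next to \<open>a\<close> on the way to \<open>b\<close> has the parity of
  \<open>Suc k\<close>, which makes the step between \<open>d\<close> and \<open>a\<close> point in the direction required. The bound on \<open>d\<close> keeps
  the walk among the colours in use, and a walk from a colour to itself is made to rest so that
  points which keep their colour are never recoloured on the way.\<close>

lemma fence_reach_Suc:
  assumes "fence_reach (Suc k) b a"
  obtains d where "fence_reach k b d" "d \<le> max a b" "b = a \<Longrightarrow> d = a"
    "if even k then fence_le d a else fence_le a d"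
proof (cases "fence_reach k b a")
  case True
  show thesis by (rule that[of a]) (use True in auto)
next
  case False
  define d where "d = (if a < b then Suc a else a - 1)"
  have ne: "a \<noteq> b" and len: "\<bar>int a - int b\<bar> + (if even b then 1 else 0) = int k + 1"
    using assms False by (auto simp: fence_reach_def)
  have dist: "\<bar>int d - int b\<bar> + (if even b then 1 else 0) = int k"
    using ne len by (auto simp: d_def)
  have adj: "d = Suc a \<or> a = Suc d"
    using ne by (auto simp: d_def)
  have par: "even d \<longleftrightarrow> odd k"
    using arg_cong[OF dist, of even] by (cases "even b") auto
  show thesis
  proof (rule that[of d])
    show "fence_reach k b d" using dist by (simp add: fence_reach_def)
    show "d \<le> max a b" by (auto simp: d_def)
    show "d = a" if "b = a" using that ne by simp
    show "if even k then fence_le d a else fence_le a d"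
      using par adj by (auto simp: fence_le_def)
  qed
qed

section \<open>Permutations changing finitely many colours\<close>

definition recolour_group :: "(nat \<Rightarrow> nat) \<Rightarrow> seq_monoid" where
  "recolour_group c =
     \<lparr>carrier = {f. bij f \<and> finite {x. c (f x) \<noteq> c x}}, mult = (\<circ>), one = id\<rparr>"

definition lowering :: "(nat \<Rightarrow> nat) \<Rightarrow> (nat \<Rightarrow> nat) set" where
  "lowering c = {f \<in> carrier (recolour_group c). \<forall>x. fence_le (c (f x)) (c x)}"

lemma recolour_group_simps [simp]:
  "f \<in> carrier (recolour_group c) \<longleftrightarrow> bij f \<and> finite {x. c (f x) \<noteq> c x}"
  "f \<otimes>\<^bsub>recolour_group c\<^esub> g = f \<circ> g"
  "\<one>\<^bsub>recolour_group c\<^esub> = id"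
  by (auto simp: recolour_group_def)

lemma recolour_comp:
  assumes "f \<in> carrier (recolour_group c)" "g \<in> carrier (recolour_group c)"
  shows "f \<circ> g \<in> carrier (recolour_group c)"
proof -
  have "finite (g -` {x. c (f x) \<noteq> c x})"
    using assms by (intro finite_vimageI) (auto simp: bij_is_inj)
  then have "finite ({x. c (g x) \<noteq> c x} \<union> g -` {x. c (f x) \<noteq> c x})"
    using assms by simp
  then have "finite {x. c (f (g x)) \<noteq> c x}"
    by (rule rev_finite_subset) auto
  then show ?thesis using assms by (auto intro: bij_comp)
qed

lemma recolour_inv:
  assumes "f \<in> carrier (recolour_group c)"
  shows "inv_into UNIV f \<in> carrier (recolour_group c)"
proof -
  have f: "bij f" using assms by simp
  have "finite (f ` {x. c (f x) \<noteq> c x})" using assms by simp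
  moreover have "{x. c (inv_into UNIV f x) \<noteq> c x} \<subseteq> f ` {x. c (f x) \<noteq> c x}"
  proof
    fix x assume x: "x \<in> {x. c (inv_into UNIV f x) \<noteq> c x}"
    have "x = f (inv_into UNIV f x)" using f by (simp add: bij_is_surj surj_f_inv_f)
    then show "x \<in> f ` {x. c (f x) \<noteq> c x}"
      using x by (intro image_eqI[where x = "inv_into UNIV f x"]) auto
  qed
  ultimately show ?thesis
    using f by (auto intro: bij_imp_bij_inv finite_subset)
qed

lemma group_recolour_group: "group (recolour_group c)"
proof (rule groupI)
  fix f assume f: "f \<in> carrier (recolour_group c)"
  then have "inv_into UNIV f \<circ> f = id" by (simp add: bij_is_inj)
  then show "\<exists>g\<in>carrier (recolour_group c). g \<otimes>\<^bsub>recolour_group c\<^esub> f = \<one>\<^bsub>recolour_group c\<^esub>"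
    using recolour_inv[OF f] by auto
next
  fix f g assume "f \<in> carrier (recolour_group c)" "g \<in> carrier (recolour_group c)"
  then show "f \<otimes>\<^bsub>recolour_group c\<^esub> g \<in> carrier (recolour_group c)"
    using recolour_comp[of f c g] by simp
qed (auto simp: o_assoc)

lemma subsemigroup_lowering: "subsemigroup (lowering c) (recolour_group c)"
  unfolding subsemigroup_def
proof (intro conjI ballI)
  fix f g assume "f \<in> lowering c" "g \<in> lowering c"
  then show "f \<otimes>\<^bsub>recolour_group c\<^esub> g \<in> lowering c"
    using recolour_comp[of f c g] by (auto simp: lowering_def intro: fence_le_trans)
qed (auto simp: lowering_def)

lemma set_inv_lowering:
  "set_inv\<^bsub>recolour_group c\<^esub> (lowering c) =
     {f \<in> carrier (recolour_group c). \<forall>x. fence_le (c x) (c (f x))}" (is "?L = ?R")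
proof
  interpret group "recolour_group c" by (rule group_recolour_group)
  show "?L \<subseteq> ?R"
  proof
    fix f assume "f \<in> ?L"
    then obtain h where h: "h \<in> lowering c" and f: "f = inv\<^bsub>recolour_group c\<^esub> h"
      by (auto simp: SET_INV_def)
    have hG: "h \<in> carrier (recolour_group c)" using h by (simp add: lowering_def)
    have fG: "f \<in> carrier (recolour_group c)" unfolding f by (rule inv_closed[OF hG])
    have "h \<circ> f = id" using r_inv[OF hG] by (simp add: f)
    then have "h (f x) = x" for x by (metis comp_apply id_apply)
    then have "fence_le (c x) (c (f x))" for x
      using h by (metis (no_types, lifting) lowering_def mem_Collect_eq)
    then show "f \<in> ?R" using fG by simp
  qed
  show "?R \<subseteq> ?L"
  proof
    fix f assume f: "f \<in> ?R"
    then have fG: "f \<in> carrier (recolour_group c)" and b: "bij f" by simp_all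
    define h where "h = inv_into UNIV f"
    have hG: "h \<in> carrier (recolour_group c)"
      unfolding h_def by (rule recolour_inv[OF fG])
    have fh: "f (h x) = x" for x unfolding h_def using b by (simp add: bij_is_surj surj_f_inv_f)
    have "fence_le (c (h x)) (c x)" for x
      using f fh[of x] by (metis (no_types, lifting) mem_Collect_eq)
    then have "h \<in> lowering c" using hG by (simp add: lowering_def)
    moreover have "inv\<^bsub>recolour_group c\<^esub> h = f"
      by (rule inv_equality) (use fG hG fh in \<open>auto simp: fun_eq_iff\<close>)
    ultimately show "f \<in> ?L" by (auto simp: SET_INV_def)
  qed
qed

section \<open>Lower bound for the number of factors\<close>

text \<open>Each factor changes a colour by at most \<open>1\<close>. The bound is \<open>k\<close> for \<open>Suc k\<close> factors because the
  leftmost factor would have to raise a point to the maximal colour \<open>0\<close> and therefore contributes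
  nothing.\<close>

lemma alt_prod_colour_bound:
  assumes "g \<in> alt_prod (recolour_group c) (lowering c) (Suc k)" "c (g x) = 0"
  shows "c x \<le> k"
  using assms
proof (induction k arbitrary: g x)
  case 0
  then have "g \<in> lowering c" by (simp add: set_mult_def)
  then have "fence_le (c (g x)) (c x)" by (simp add: lowering_def)
  then show ?case using 0(2) by (simp add: fence_le_def)
next
  case (Suc k)
  then obtain h s where h: "h \<in> alt_prod (recolour_group c) (lowering c) (Suc k)"
    and s: "s \<in> lowering c \<union> set_inv\<^bsub>recolour_group c\<^esub> (lowering c)" and g: "g = h \<circ> s"
    unfolding alt_prod.simps(2)[of _ _ "Suc k"] set_mult_def by (auto split: if_splits)
  have "c (s x) \<le> k" using Suc.IH[OF h] Suc.prems(2) by (simp add: g)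
  moreover have "fence_le (c (s x)) (c x) \<or> fence_le (c x) (c (s x))"
    using s by (auto simp: set_inv_lowering) (simp add: lowering_def)
  ultimately show ?case by (auto simp: fence_le_def)
qed

section \<open>Factorising by walks in the fence\<close>

text \<open>The fibres of both colourings are infinite sets of natural numbers, so they can be matched
  colour by colour.\<close>

lemma ex_perm_colouring:
  fixes c c' :: "nat \<Rightarrow> nat"
  assumes inf: "\<And>k. k \<in> range c \<Longrightarrow> infinite {x. c x = k}"
    and rng: "range c' \<subseteq> range c"
    and fin: "finite {x. c' x \<noteq> c x}"
  obtains f where "bij f" "\<And>x. c (f x) = c' x"
proof -
  have inf': "infinite {x. c' x = k}" if "k \<in> range c" for k
  proof
    assume "finite {x. c' x = k}"
    then have "finite ({x. c' x = k} \<union> {x. c' x \<noteq> c x})" using fin by simp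
    then have "finite {x. c x = k}" by (rule rev_finite_subset) auto
    then show False using inf[OF that] by simp
  qed
  have "\<exists>F. bij_betw F {x. c' x = k} {x. c x = k}" if "k \<in> range c" for k
    using bij_enumerate[OF inf[OF that]] bij_betw_inv_into[OF bij_enumerate[OF inf'[OF that]]]
    by (meson bij_betw_trans)
  then obtain F where F: "bij_betw (F k) {x. c' x = k} {x. c x = k}" if "k \<in> range c" for k
    by metis
  define f where "f x = F (c' x) x" for x
  have cf: "c (f x) = c' x" for x
    using bij_betwE[OF F[of "c' x"]] rng by (auto simp: f_def)
  have "inj f"
  proof (rule injI)
    fix x y assume eq: "f x = f y"
    then have col: "c' x = c' y" using cf by metis
    have "inj_on (F (c' x)) {z. c' z = c' x}"
      using F[of "c' x"] rng by (auto simp: bij_betw_def)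
    then show "x = y" using eq col by (auto simp: f_def inj_on_def)
  qed
  moreover have "surj f"
  proof -
    have "\<exists>x. f x = y" for y
    proof -
      have "y \<in> F (c y) ` {x. c' x = c y}"
        using F[of "c y"] by (auto simp: bij_betw_def)
      then obtain x where "y = F (c y) x" "c' x = c y" by blast
      then have "f x = y" by (simp add: f_def)
      then show ?thesis ..
    qed
    then show ?thesis by (metis surjI surj_def)
  qed
  ultimately show thesis using cf by (intro that[of f]) (auto simp: bij_def)
qed

text \<open>The last factor \<open>s\<close> is chosen so as to perform the step of every walk next to the original
  colour; the quotient \<open>g \<circ> s\<^sup>-\<^sup>1\<close> then has walks that are shorter by one.\<close>

lemma alt_prodI:
  assumes inf: "\<And>k. k < n \<Longrightarrow> infinite {x. c x = k}"
    and rng: "range c = {..<n}"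
    and "g \<in> carrier (recolour_group c)"
    and "\<And>x. fence_reach (Suc k) (c (g x)) (c x)"
  shows "g \<in> alt_prod (recolour_group c) (lowering c) (Suc k)"
  using assms(3,4)
proof (induction k arbitrary: g)
  case 0
  interpret group "recolour_group c" by (rule group_recolour_group)
  have "g \<in> lowering c"
    using 0 by (auto simp: lowering_def intro: fence_reach_1)
  then show ?case
    by (subst alt_prod_Suc_0) (auto simp: lowering_def)
next
  case (Suc k)
  have "\<exists>d. fence_reach (Suc k) (c (g x)) d \<and> d \<le> max (c x) (c (g x)) \<and>
      (c (g x) = c x \<longrightarrow> d = c x) \<and>
      (if even (Suc k) then fence_le d (c x) else fence_le (c x) d)" for x
    using fence_reach_Suc[OF Suc.prems(2)[of x]] by metis
  then obtain c' where c': "fence_reach (Suc k) (c (g x)) (c' x)"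
      "c' x \<le> max (c x) (c (g x))" "c (g x) = c x \<Longrightarrow> c' x = c x"
      "if even (Suc k) then fence_le (c' x) (c x) else fence_le (c x) (c' x)" for x
    by metis
  have fin: "finite {x. c' x \<noteq> c x}"
    by (rule finite_subset[of _ "{x. c (g x) \<noteq> c x}"]) (use c'(3) Suc.prems(1) in auto)
  have "c x < n" for x using rng by auto
  then have "c' x < n" for x
    using c'(2)[of x] by (metis le_less_trans max_less_iff_conj)
  then have "range c' \<subseteq> range c" using rng by auto
  then obtain s where s: "bij s" "\<And>x. c (s x) = c' x"
    using ex_perm_colouring[of c c'] inf rng fin by auto
  have sG: "s \<in> carrier (recolour_group c)" using s fin by simp
  define h where "h = g \<circ> inv_into UNIV s"
  have g: "g = h \<circ> s"
    using s(1) by (auto simp: h_def fun_eq_iff bij_is_inj)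
  have "h \<in> alt_prod (recolour_group c) (lowering c) (Suc k)"
  proof (rule Suc.IH)
    show "h \<in> carrier (recolour_group c)"
      unfolding h_def by (rule recolour_comp[OF Suc.prems(1) recolour_inv[OF sG]])
    show "fence_reach (Suc k) (c (h x)) (c x)" for x
    proof -
      obtain y where "x = s y" using s(1) by (metis bij_pointE)
      then show ?thesis using c'(1)[of y] s(2) by (simp add: g)
    qed
  qed
  moreover have "s \<in> (if even (Suc k) then lowering c
      else set_inv\<^bsub>recolour_group c\<^esub> (lowering c))"
  proof (cases "even (Suc k)")
    case True
    then show ?thesis using sG c'(4) s(2) by (simp add: lowering_def)
  next
    case False
    then show ?thesis using sG c'(4) s(2) unfolding set_inv_lowering by simp
  qed
  ultimately have "h \<otimes>\<^bsub>recolour_group c\<^esub> s \<in> alt_prod (recolour_group c) (lowering c) (Suc (Suc k))"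
    unfolding alt_prod.simps(2)[of _ _ "Suc k"] set_mult_def by blast
  then show ?case by (simp only: g recolour_group_simps)
qed

section \<open>Colouring by residues\<close>

theorem mainTheorem1:
  fixes n :: nat
  assumes "1 \<le> n"
  shows "\<exists>(G :: seq_monoid) M. group G \<and> subsemigroup M G \<and>
           alt_prod G M n = carrier G \<and>
           (\<forall>m. 1 \<le> m \<and> m < n \<longrightarrow> alt_prod G M m \<noteq> carrier G)"
proof -
  define c where "c x = x mod n" for x :: nat
  let ?G = "recolour_group c" and ?M = "lowering c"
  interpret group ?G by (rule group_recolour_group)
  have lt: "c x < n" for x using assms by (simp add: c_def)
  have inf: "infinite {x. c x = k}" if "k < n" for k
  proof -
    have "inj (\<lambda>i. k + i * n)" using assms by (auto simp: inj_def)
    then have "infinite (range (\<lambda>i. k + i * n))" by (rule range_inj_infinite)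
    then show ?thesis
      by (rule infinite_super[rotated]) (use that in \<open>auto simp: c_def\<close>)
  qed
  have rng: "range c = {..<n}"
  proof
    show "{..<n} \<subseteq> range c" by (auto simp: c_def image_iff intro: mod_less[symmetric])
  qed (use lt in auto)
  have MG: "?M \<subseteq> carrier ?G" by (auto simp: lowering_def)
  have "alt_prod ?G ?M k \<subseteq> carrier ?G" for k
  proof (induction k)
    case (Suc k)
    have "(if even k then ?M else set_inv\<^bsub>?G\<^esub> ?M) \<subseteq> carrier ?G"
      using MG unfolding set_inv_lowering by auto
    then show ?case
      unfolding alt_prod.simps by (rule set_mult_closed[OF Suc.IH])
  qed simp
  moreover have "carrier ?G \<subseteq> alt_prod ?G ?M n"
  proof
    fix g assume g: "g \<in> carrier ?G"
    obtain k where k: "n = Suc k" using assms by (cases n) auto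
    show "g \<in> alt_prod ?G ?M n"
      unfolding k
      by (rule alt_prodI[OF inf rng g]) (use lt fence_reach_full k in auto)
  qed
  moreover have "alt_prod ?G ?M m \<noteq> carrier ?G" if m: "1 \<le> m" "m < n" for m
  proof
    assume eq: "alt_prod ?G ?M m = carrier ?G"
    let ?t = "transpose 0 (n - 1)"
    have "finite {x. c (?t x) \<noteq> c x}"
      by (rule finite_subset[of _ "{0, n - 1}"]) (auto simp: transpose_def)
    then have "?t \<in> alt_prod ?G ?M (Suc (m - 1))" using eq m by simp
    moreover have "c (?t (n - 1)) = 0" by (simp add: c_def)
    ultimately have "c (n - 1) \<le> m - 1" by (rule alt_prod_colour_bound)
    then show False using m by (simp add: c_def)
  qed
  ultimately show ?thesis
    using group_recolour_group subsemigroup_lowering by blast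
qed

end
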